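(* Let $n,k$ be positive integers with $n\geq k$, and let $\mathcal{P}$ be a Hamming intersecting family of $k$-permutations on $[n]$. Then $$|\mathcal{P}|\leq\frac{(n-1)!}{(n-k)!}.$$ Furthermore, $|\mathcal{P}|=\frac{(n-1)!}{(n-k)!}$ is attained when $\mathcal{P}$ is a trivial family.
   Context: $[n]=\{1,2,\ldots,n\}$. A $k$-permutation on $[n]$ is an ordered $k$-set, i.e. a sequence $(p_1,\ldots,p_k)$ of $k$ pairwise distinct elements of $[n]$. For two sequences $P=(p_1,\ldots,p_k)$ and $Q=(q_1,\ldots,q_k)$, the size of the Hamming intersection, $|P\cap_H Q|$, is the number of positions $i\in\{1,\ldots,k\}$ with $p_i=q_i$. A family $\mathcal{P}$ of distinct $k$-permutations is Hamming intersecting if $|P\cap_H Q|\geq 1$ for all $P,Q\in\mathcal{P}$. A trivial family is one consisting of all $k$-permutations on $[n]$ in which a fixed element $x\in[n]$ appears in a fixed position $i\in\{1,\ldots,k\}$. *)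

theory Defs
  imports Complex_Main
begin

text \<open>A \<open>k\<close>-permutation on \<open>[n]\<close> is a list over \<open>{1..n}\<close>. List positions
  count from \<open>0\<close>, so position \<open>i\<close> in \<open>{1,\<dots>,k}\<close> is the list index \<open>i - 1\<close>.\<close>

definition k_permutations :: "nat \<Rightarrow> nat \<Rightarrow> nat list set" where
  "k_permutations n k = {p. length p = k \<and> distinct p \<and> set p \<subseteq> {1..n}}"

text \<open>The minimum only makes the definition meaningful for lists of different lengths;
  in a family of \<open>k\<close>-permutations both lengths are \<open>k\<close>.\<close>

definition hamming_inter_size :: "'a list \<Rightarrow> 'a list \<Rightarrow> nat" where
  "hamming_inter_size p q = card {i. i < min (length p) (length q) \<and> p ! i = q ! i}"

definition hamming_intersecting :: "'a list set \<Rightarrow> bool" where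
  "hamming_intersecting F \<longleftrightarrow> (\<forall>p\<in>F. \<forall>q\<in>F. hamming_inter_size p q \<ge> 1)"

definition trivial_family :: "nat \<Rightarrow> nat \<Rightarrow> nat \<Rightarrow> nat \<Rightarrow> nat list set" where
  "trivial_family n k x i = {p \<in> k_permutations n k. p ! i = x}"

end

theory Submission
  imports Defs
begin

text \<open>
  Shifting all entries of a \<open>k\<close>-permutation cyclically by \<open>j\<close> modulo \<open>n\<close> gives another
  \<open>k\<close>-permutation. A nonzero shift of \<open>p\<close> disagrees with \<open>p\<close> in every position, so each orbit,
  which has \<open>n\<close> elements, contains at most one member of a Hamming intersecting family. As
  there are \<open>n! / (n - k)!\<close> \<open>k\<close>-permutations, the bound follows; a trivial family meets every
  orbit, because some shift brings \<open>x\<close> to position \<open>i\<close>.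
\<close>

text \<open>\<open>Suc\<close> moves the residues into \<open>{1..n}\<close>, so parameter
  \<open>j\<close> adds \<open>j + 1\<close> modulo \<open>n\<close>, and on \<open>{1..n}\<close>
  the identity is \<open>j = n - 1\<close>. As \<open>j\<close> runs through \<open>{..<n}\<close>,
  every shift occurs once.\<close>

definition cyclic_shift :: "nat \<Rightarrow> nat \<Rightarrow> nat \<Rightarrow> nat" where
  "cyclic_shift n j v = Suc ((j + v) mod n)"

text \<open>\<open>n\<close> divides the difference of \<open>v\<close> and \<open>w\<close>, which
  is smaller than \<open>n\<close>. Bounding only the difference lets this serve both entries in
  \<open>{1..n}\<close> and shift amounts in \<open>{..<n}\<close>.\<close>

lemma add_mod_left_cancel:
  fixes a v w n :: nat
  assumes "(a + v) mod n = (a + w) mod n" "v < w + n" "w < v + n"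
  shows "v = w"
  using assms
proof (induction v w rule: linorder_wlog)
  case (le v w)
  then have "n dvd w - v"
    using mod_eq_dvd_iff_nat[of "a + v" "a + w" n] by simp
  with le show ?case
    by (auto dest: dvd_imp_le)
qed simp

lemma cyclic_shift_in_range: "n > 0 \<Longrightarrow> cyclic_shift n j v \<in> {1..n}"
  by (simp add: cyclic_shift_def Suc_le_eq)

lemma inj_on_cyclic_shift: "inj_on (cyclic_shift n j) {1..n}"
  by (rule inj_onI, rule add_mod_left_cancel[of j _ n]) (auto simp: cyclic_shift_def)

lemma inj_on_cyclic_shift_amount: "inj_on (\<lambda>j. cyclic_shift n j v) {..<n}"
  by (rule inj_onI, rule add_mod_left_cancel[of v _ n]) (auto simp: cyclic_shift_def add.commute)

lemma bij_betw_cyclic_shift: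
  assumes "n > 0"
  shows "bij_betw (cyclic_shift n j) {1..n} {1..n}"
proof -
  have "cyclic_shift n j ` {1..n} \<subseteq> {1..n}"
    using cyclic_shift_in_range[OF assms] by blast
  then show ?thesis
    unfolding bij_betw_def
    by (intro conjI inj_on_cyclic_shift endo_inj_surj finite_atLeastAtMost)
qed

text \<open>The \<open>n\<close> shift amounts send \<open>v\<close> to \<open>n\<close> different
  values in \<open>{1..n}\<close>, hence to all of them.\<close>

lemma cyclic_shift_transitive:
  assumes "y \<in> {1..n}"
  obtains j where "j < n" "cyclic_shift n j v = y"
proof -
  have "n > 0" using assms by simp
  then have "(\<lambda>j. cyclic_shift n j v) ` {..<n} \<subseteq> {1..n}"
    using cyclic_shift_in_range by blast
  moreover have "card ((\<lambda>j. cyclic_shift n j v) ` {..<n}) = card {1..n}"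
    by (simp add: card_image inj_on_cyclic_shift_amount)
  ultimately have "(\<lambda>j. cyclic_shift n j v) ` {..<n} = {1..n}"
    by (intro card_subset_eq) auto
  with assms obtain j where "j < n" "cyclic_shift n j v = y"
    by (metis imageE lessThan_iff)
  with that show thesis .
qed

text \<open>Stated for any bijection because it is applied to shifts and to their inverses.\<close>

lemma map_k_permutations:
  assumes "bij_betw f {1..n} {1..n}" "p \<in> k_permutations n k"
  shows "map f p \<in> k_permutations n k"
proof -
  have p: "length p = k" "distinct p" "set p \<subseteq> {1..n}"
    using assms(2) by (auto simp: k_permutations_def)
  have "inj_on f (set p)" "f ` set p \<subseteq> {1..n}"
    using assms(1) p(3) unfolding bij_betw_def by (blast intro: inj_on_subset)+
  with p show ?thesis
    by (simp add: k_permutations_def distinct_map)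
qed

lemma finite_k_permutations: "finite (k_permutations n k)"
  unfolding k_permutations_def
  by (rule finite_subset[OF _ finite_lists_length_eq[of "{1..n}" k]]) auto

lemma card_k_permutations:
  assumes "k \<le> n"
  shows "card (k_permutations n k) * fact (n - k) = fact n"
proof -
  have "card (k_permutations n k) = \<Prod>{n - k + 1..n}"
    using card_lists_distinct_length_eq[of "{1..n}" k] assms by (simp add: k_permutations_def)
  also have "\<dots> * fact (n - k) = fact n"
    using fact_eq_fact_times[of "n - k" n] by (simp add: mult.commute)
  finally show ?thesis .
qed

lemma hamming_inter_size_pos_iff:
  "hamming_inter_size p q \<ge> 1 \<longleftrightarrow> (\<exists>i < min (length p) (length q). p ! i = q ! i)"
  unfolding hamming_inter_size_def by (auto simp: Suc_le_eq card_gt_0_iff)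

lemma hamming_intersecting_trivial_family:
  "i < k \<Longrightarrow> hamming_intersecting (trivial_family n k x i)"
  by (auto simp: hamming_intersecting_def hamming_inter_size_pos_iff
      trivial_family_def k_permutations_def simp del: One_nat_def)

text \<open>If shifts of \<open>p\<close> and \<open>q\<close> coincide, then at a position where
  \<open>p\<close> and \<open>q\<close> agree one entry has the same image under both shifts. This
  forces equal amounts, and the common shift can be cancelled.\<close>

lemma inj_on_shift_family:
  assumes F: "F \<subseteq> k_permutations n k" "hamming_intersecting F"
  shows "inj_on (\<lambda>(j, p). map (cyclic_shift n j) p) ({..<n} \<times> F)"
proof (rule inj_onI, clarify)
  fix j p l q
  assume *: "j < n" "p \<in> F" "l < n" "q \<in> F"
    and eq: "map (cyclic_shift n j) p = map (cyclic_shift n l) q"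
  obtain i where i: "i < length p" "i < length q" "p ! i = q ! i"
    using F(2) * unfolding hamming_intersecting_def hamming_inter_size_pos_iff by force
  then have "cyclic_shift n j (p ! i) = cyclic_shift n l (p ! i)"
    using eq by (metis nth_map)
  with * have jl: "j = l"
    using inj_onD[OF inj_on_cyclic_shift_amount] by blast
  \<comment> \<open>Cancelling the map compares entries of \<open>p\<close> with entries of
    \<open>q\<close>, so injectivity is needed on the union.\<close>
  have "set p \<union> set q \<subseteq> {1..n}"
    using F(1) * by (auto simp: k_permutations_def)
  then have "inj_on (cyclic_shift n j) (set p \<union> set q)"
    by (rule inj_on_subset[OF inj_on_cyclic_shift])
  with eq jl have "p = q"
    by (simp add: map_inj_on)
  with jl show "j = l \<and> p = q" by simp
qed

lemma shift_family_subset: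
  assumes "F \<subseteq> k_permutations n k"
  shows "(\<lambda>(j, p). map (cyclic_shift n j) p) ` ({..<n} \<times> F) \<subseteq> k_permutations n k"
  using assms by (auto intro!: map_k_permutations bij_betw_cyclic_shift)

lemma card_hamming_intersecting_le:
  assumes "F \<subseteq> k_permutations n k" "hamming_intersecting F"
  shows "n * card F \<le> card (k_permutations n k)"
  using card_inj_on_le[OF inj_on_shift_family shift_family_subset finite_k_permutations] assms
  by (simp add: card_cartesian_product)

text \<open>Given \<open>q\<close>, choose the shift that takes \<open>x\<close> to
  \<open>q ! i\<close> and undo it on all of \<open>q\<close>.\<close>

lemma shift_trivial_family:
  assumes "x \<in> {1..n}" "i < k"
  shows "(\<lambda>(j, p). map (cyclic_shift n j) p) ` ({..<n} \<times> trivial_family n k x i)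
    = k_permutations n k"
proof
  show "(\<lambda>(j, p). map (cyclic_shift n j) p) ` ({..<n} \<times> trivial_family n k x i)
    \<subseteq> k_permutations n k"
    by (intro shift_family_subset) (auto simp: trivial_family_def)
  show "k_permutations n k
    \<subseteq> (\<lambda>(j, p). map (cyclic_shift n j) p) ` ({..<n} \<times> trivial_family n k x i)"
  proof
    fix q assume q: "q \<in> k_permutations n k"
    then have len: "length q = k" and sub: "set q \<subseteq> {1..n}"
      by (auto simp: k_permutations_def)
    have "q ! i \<in> {1..n}"
      using sub len assms(2) nth_mem by blast
    then obtain j where j: "j < n" "cyclic_shift n j x = q ! i"
      using cyclic_shift_transitive by blast
    have bij: "bij_betw (cyclic_shift n j) {1..n} {1..n}"
      using j by (intro bij_betw_cyclic_shift) simp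
    define p where "p = map (inv_into {1..n} (cyclic_shift n j)) q"
    have "p \<in> k_permutations n k"
      unfolding p_def using bij q by (intro map_k_permutations bij_betw_inv_into)
    moreover have "p ! i = x"
      using assms len bij_betw_inv_into_left[OF bij] by (simp add: p_def flip: j(2))
    moreover have "map (cyclic_shift n j) p = q"
      unfolding p_def map_map
      using sub bij_betw_inv_into_right[OF bij] by (intro map_idI) auto
    ultimately show
      "q \<in> (\<lambda>(j, p). map (cyclic_shift n j) p) ` ({..<n} \<times> trivial_family n k x i)"
      using j by (force simp: trivial_family_def)
  qed
qed

text \<open>A trivial family is itself intersecting, so its shifts are distinct as well as
  exhaustive.\<close>

lemma card_trivial_family:
  assumes "x \<in> {1..n}" "i < k"
  shows "n * card (trivial_family n k x i) = card (k_permutations n k)"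
proof -
  have "trivial_family n k x i \<subseteq> k_permutations n k"
    by (auto simp: trivial_family_def)
  from card_image[OF inj_on_shift_family[OF this hamming_intersecting_trivial_family[OF assms(2)]]]
  show ?thesis
    using shift_trivial_family[OF assms] by (simp add: card_cartesian_product)
qed

theorem theorem4p1:
  fixes n k :: nat
  assumes "n > 0" and "k > 0" and "n \<ge> k"
  shows "(\<forall>F. F \<subseteq> k_permutations n k \<and> hamming_intersecting F \<longrightarrow>
            real (card F) \<le> fact (n - 1) / fact (n - k))
       \<and> (\<forall>x\<in>{1..n}. \<forall>i<k.
            hamming_intersecting (trivial_family n k x i) \<and>
            real (card (trivial_family n k x i)) = fact (n - 1) / fact (n - k))"
proof -
  have "real (card (k_permutations n k)) * fact (n - k) = fact n"
    using arg_cong[OF card_k_permutations[OF assms(3)], of real] by simp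
  then have *: "real (card (k_permutations n k)) = real n * (fact (n - 1) / fact (n - k))"
    using assms(1) by (simp add: field_simps fact_reduce)
  \<comment> \<open>Multiplying by \<open>n > 0\<close> turns the quotient into the number of all
    \<open>k\<close>-permutations, so both claims reduce to the counts over the naturals.\<close>
  have le_iff: "real c \<le> fact (n - 1) / fact (n - k)
      \<longleftrightarrow> n * c \<le> card (k_permutations n k)" for c
    unfolding of_nat_le_iff[where 'a = real, symmetric] * of_nat_mult
    using assms(1) by (subst mult_le_cancel_left_pos) simp_all
  have eq_iff: "real c = fact (n - 1) / fact (n - k)
      \<longleftrightarrow> n * c = card (k_permutations n k)" for c
    unfolding of_nat_eq_iff[where 'a = real, symmetric] * of_nat_mult
    using assms(1) by (subst mult_left_cancel) simp_all
  show ?thesis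
    unfolding le_iff eq_iff
    by (intro conjI allI impI ballI card_hamming_intersecting_le card_trivial_family
        hamming_intersecting_trivial_family) simp_all
qed

end
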